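(* Let $\Gamma \cup \{\varphi\} \subseteq \mathfrak{F}_{\{\land,\lor\}}$. Then $\Gamma \vdash_{\{\land,\lor\}} \varphi$ if and only if $\Gamma \vDash_{\mathbf{2}} \varphi$.
   Context: Let $\Pi$ be an infinite set of propositional letters. $\mathfrak{F}_{\{\land,\lor\}}$ is the set of formulas built from $\Pi$ using only the binary connectives $\land$ and $\lor$. Derivability $\vdash_{\{\land,\lor\}}$ is the smallest relation between sets of formulas of $\mathfrak{F}_{\{\land,\lor\}}$ and formulas of $\mathfrak{F}_{\{\land,\lor\}}$ satisfying: (R$_\in$) if $\varphi \in \Gamma$, then $\Gamma \vdash \varphi$; (R$_m$) if $\Gamma \vdash \varphi$, then $\Gamma, \psi \vdash \varphi$; (R$_t$) if $\Gamma \vdash \varphi$ and $\Delta, \varphi \vdash \psi$, then $\Gamma, \Delta \vdash \psi$; (R$_\land$) $\Gamma \vdash \varphi \land \psi$ iff $\Gamma \vdash \varphi$ and $\Gamma \vdash \psi$; (R$_\lor$) $\Gamma, \varphi \lor \psi \vdash \chi$ iff $\Gamma, \varphi \vdash \chi$ and $\Gamma, \psi \vdash \chi$. $\mathbf{2}$ is the algebra $\langle \{0,1\}; \land, \lor\rangle$ where $\land$ and $\lor$ are the meet (minimum) and join (maximum) for the order $0<1$, with set of designated values $D=\{1\}$. $\Gamma \vDash_{\mathbf{2}} \varphi$ means: for every assignment $v : \Pi \to \{0,1\}$, with unique homomorphic extension $\bar v : \mathfrak{F}_{\{\land,\lor\}} \to \{0,1\}$, if $\bar v(\psi) = 1$ for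 all $\psi \in \Gamma$, then $\bar v(\varphi) = 1$. *)

theory Defs
  imports Main
begin

text \<open>The propositional letters are the elements of the type \<open>'p\<close>; that there are
  infinitely many of them is a hypothesis of the theorem.\<close>

datatype 'p fm =
    Atom 'p
  | Conj "'p fm" "'p fm"  (infixr \<open>\<^bold>\<and>\<close> 75)
  | Disj "'p fm" "'p fm"  (infixr \<open>\<^bold>\<or>\<close> 70)

text \<open>Derivability is the smallest relation closed under the rules below. The two
  biconditional rules for conjunction and disjunction are split into their Horn
  clauses: \<open>Conj_I\<close>, \<open>Conj_E1\<close>, \<open>Conj_E2\<close> and \<open>Disj_I\<close>, \<open>Disj_E1\<close>, \<open>Disj_E2\<close>.
  Sets of premises may be infinite, and \<open>Mono\<close> adds a single formula at a time.\<close>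

inductive derives :: "'p fm set \<Rightarrow> 'p fm \<Rightarrow> bool"  (infix \<open>\<turnstile>\<close> 50) where
  Mem: "\<phi> \<in> \<Gamma> \<Longrightarrow> \<Gamma> \<turnstile> \<phi>"
| Mono: "\<Gamma> \<turnstile> \<phi> \<Longrightarrow> \<Gamma> \<union> {\<psi>} \<turnstile> \<phi>"
| Trans: "\<Gamma> \<turnstile> \<phi> \<Longrightarrow> \<Delta> \<union> {\<phi>} \<turnstile> \<psi> \<Longrightarrow> \<Gamma> \<union> \<Delta> \<turnstile> \<psi>"
| Conj_I: "\<Gamma> \<turnstile> \<phi> \<Longrightarrow> \<Gamma> \<turnstile> \<psi> \<Longrightarrow> \<Gamma> \<turnstile> \<phi> \<^bold>\<and> \<psi>"
| Conj_E1: "\<Gamma> \<turnstile> \<phi> \<^bold>\<and> \<psi> \<Longrightarrow> \<Gamma> \<turnstile> \<phi>"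
| Conj_E2: "\<Gamma> \<turnstile> \<phi> \<^bold>\<and> \<psi> \<Longrightarrow> \<Gamma> \<turnstile> \<psi>"
| Disj_I: "\<Gamma> \<union> {\<phi>} \<turnstile> \<chi> \<Longrightarrow> \<Gamma> \<union> {\<psi>} \<turnstile> \<chi> \<Longrightarrow> \<Gamma> \<union> {\<phi> \<^bold>\<or> \<psi>} \<turnstile> \<chi>"
| Disj_E1: "\<Gamma> \<union> {\<phi> \<^bold>\<or> \<psi>} \<turnstile> \<chi> \<Longrightarrow> \<Gamma> \<union> {\<phi>} \<turnstile> \<chi>"
| Disj_E2: "\<Gamma> \<union> {\<phi> \<^bold>\<or> \<psi>} \<turnstile> \<chi> \<Longrightarrow> \<Gamma> \<union> {\<psi>} \<turnstile> \<chi>"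

text \<open>The algebra \<open>\<^bold>2\<close> is the lattice \<open>bool\<close>, ordered by \<open>False < True\<close>, with
  designated value \<open>True\<close>; \<open>val v\<close> is the homomorphic extension of the assignment \<open>v\<close>.\<close>

primrec val :: "('p \<Rightarrow> bool) \<Rightarrow> 'p fm \<Rightarrow> bool" where
  "val v (Atom p) = v p"
| "val v (\<phi> \<^bold>\<and> \<psi>) = inf (val v \<phi>) (val v \<psi>)"
| "val v (\<phi> \<^bold>\<or> \<psi>) = sup (val v \<phi>) (val v \<psi>)"

definition entails :: "'p fm set \<Rightarrow> 'p fm \<Rightarrow> bool"  (infix \<open>\<Turnstile>\<close> 50) where
  "\<Gamma> \<Turnstile> \<phi> \<longleftrightarrow> (\<forall>v. (\<forall>\<psi>\<in>\<Gamma>. val v \<psi> = True) \<longrightarrow> val v \<phi> = True)"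

end

theory Submission imports Defs
begin

text \<open>Soundness holds because the consequence relation of \<open>\<^bold>2\<close> is itself closed under every
  rule, and derivability is the least such relation.

  For completeness, let \<open>\<phi>\<close> be underivable from \<open>\<Gamma>\<close>. A countermodel comes from a set
  \<open>\<Delta> \<supseteq> \<Gamma>\<close> that is maximal among the sets not deriving \<open>\<phi>\<close>. The relation of sets to
  formulas is not finitary by decree, since \<open>Mem\<close> admits infinite sets of premises, but
  each derivation uses only finitely many of its premises (\<open>derives_finitary\<close>). Hence the
  union of a chain of sets that do not derive \<open>\<phi>\<close> does not derive it either, and Zorn's
  lemma provides \<open>\<Delta>\<close> (\<open>maximal_non_deriving_extension\<close>). Maximality and the cut rule make
  \<open>\<Delta>\<close> closed under derivability; maximality and the rule for disjunction on the left make
  it prime. A closed prime set treats \<open>\<^bold>\<and>\<close> and \<open>\<^bold>\<or>\<close> as the lattice \<open>bool\<close> does, so it is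
  exactly the set of formulas true under the assignment that makes a letter true when it
  belongs to \<open>\<Delta>\<close> (\<open>val_maximal_iff\<close>). This assignment satisfies \<open>\<Gamma>\<close> and refutes \<open>\<phi>\<close>.\<close>

lemma soundness: "\<Gamma> \<turnstile> \<phi> \<Longrightarrow> \<Gamma> \<Turnstile> \<phi>"
  by (induction rule: derives.induct) (auto simp: entails_def)

text \<open>\<open>Mono\<close> adds one premise at a time; an arbitrary, possibly infinite, set of premises is
  added by cutting \<open>\<Gamma> \<turnstile> \<phi>\<close> against the instance \<open>\<Delta> \<union> {\<phi>} \<turnstile> \<phi>\<close> of \<open>Mem\<close>.\<close>

lemma weakening:
  assumes "\<Gamma> \<turnstile> \<phi>" "\<Gamma> \<subseteq> \<Delta>"
  shows "\<Delta> \<turnstile> \<phi>"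
proof -
  have "\<Gamma> \<union> \<Delta> \<turnstile> \<phi>"
    using assms(1) by (rule derives.Trans) (simp add: derives.Mem)
  with assms(2) show ?thesis
    by (simp add: Un_absorb1)
qed

lemma derives_Disj1:
  assumes "\<Gamma> \<turnstile> \<phi>"
  shows "\<Gamma> \<turnstile> \<phi> \<^bold>\<or> \<psi>"
proof -
  have "\<Gamma> \<union> {\<phi>} \<turnstile> \<phi> \<^bold>\<or> \<psi>"
    by (rule derives.Disj_E1[where \<psi> = \<psi>]) (simp add: derives.Mem)
  from derives.Trans[OF assms this] show ?thesis
    by simp
qed

lemma derives_Disj2:
  assumes "\<Gamma> \<turnstile> \<psi>"
  shows "\<Gamma> \<turnstile> \<phi> \<^bold>\<or> \<psi>"
proof -
  have "\<Gamma> \<union> {\<psi>} \<turnstile> \<phi> \<^bold>\<or> \<psi>"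
    by (rule derives.Disj_E2[where \<phi> = \<phi>]) (simp add: derives.Mem)
  from derives.Trans[OF assms this] show ?thesis
    by simp
qed

text \<open>A finite set of premises taken from \<open>\<Gamma> \<union> {\<psi>}\<close> can be split as a finite part of \<open>\<Gamma>\<close>
  together with \<open>\<psi>\<close>, which is the shape that the rules with a displayed premise need.\<close>

lemma finite_premises_split:
  assumes "\<exists>F. finite F \<and> F \<subseteq> \<Gamma> \<union> {\<psi>} \<and> F \<turnstile> \<phi>"
  obtains F where "finite F" "F \<subseteq> \<Gamma>" "F \<union> {\<psi>} \<turnstile> \<phi>"
proof -
  from assms obtain G where G: "finite G" "G \<subseteq> \<Gamma> \<union> {\<psi>}" "G \<turnstile> \<phi>"
    by blast
  from G(3) have "(G - {\<psi>}) \<union> {\<psi>} \<turnstile> \<phi>"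
    by (rule weakening) blast
  with G show thesis
    by (intro that[of "G - {\<psi>}"]) auto
qed

text \<open>Rule induction works because each rule has finitely many premises, so that the finite
  supports found for them can be joined.\<close>

lemma derives_finitary:
  "\<Gamma> \<turnstile> \<phi> \<Longrightarrow> \<exists>F. finite F \<and> F \<subseteq> \<Gamma> \<and> F \<turnstile> \<phi>"
proof (induction rule: derives.induct)
  case (Mem \<phi> \<Gamma>)
  then show ?case
    by (intro exI[of _ "{\<phi>}"]) (auto intro: derives.Mem)
next
  case (Mono \<Gamma> \<phi> \<psi>)
  then show ?case
    by blast
next
  case (Trans \<Gamma> \<phi> \<Delta> \<psi>)
  from Trans.IH(1) obtain F where F: "finite F" "F \<subseteq> \<Gamma>" "F \<turnstile> \<phi>"
    by blast
  obtain G where G: "finite G" "G \<subseteq> \<Delta>" "G \<union> {\<phi>} \<turnstile> \<psi>"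
    using Trans.IH(2) by (rule finite_premises_split)
  have "F \<union> G \<turnstile> \<psi>"
    using F(3) G(3) by (rule derives.Trans)
  with F G show ?case
    by (intro exI[of _ "F \<union> G"]) auto
next
  case (Conj_I \<Gamma> \<phi> \<psi>)
  then obtain F G where F: "finite F" "F \<subseteq> \<Gamma>" "F \<turnstile> \<phi>" and G: "finite G" "G \<subseteq> \<Gamma>" "G \<turnstile> \<psi>"
    by blast
  have "F \<union> G \<turnstile> \<phi> \<^bold>\<and> \<psi>"
    using weakening[OF F(3), of "F \<union> G"] weakening[OF G(3), of "F \<union> G"]
    by (auto intro: derives.Conj_I)
  with F G show ?case
    by (intro exI[of _ "F \<union> G"]) auto
next
  case (Conj_E1 \<Gamma> \<phi> \<psi>)
  then show ?case
    by (blast intro: derives.Conj_E1)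
next
  case (Conj_E2 \<Gamma> \<phi> \<psi>)
  then show ?case
    by (blast intro: derives.Conj_E2)
next
  case (Disj_I \<Gamma> \<phi> \<chi> \<psi>)
  obtain F where F: "finite F" "F \<subseteq> \<Gamma>" "F \<union> {\<phi>} \<turnstile> \<chi>"
    using Disj_I.IH(1) by (rule finite_premises_split)
  obtain G where G: "finite G" "G \<subseteq> \<Gamma>" "G \<union> {\<psi>} \<turnstile> \<chi>"
    using Disj_I.IH(2) by (rule finite_premises_split)
  have "(F \<union> G) \<union> {\<phi> \<^bold>\<or> \<psi>} \<turnstile> \<chi>"
    by (rule derives.Disj_I; rule weakening[OF F(3)] weakening[OF G(3)]; blast)
  with F G show ?case
    by (intro exI[of _ "F \<union> G \<union> {\<phi> \<^bold>\<or> \<psi>}"]) auto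
next
  case (Disj_E1 \<Gamma> \<phi> \<psi> \<chi>)
  obtain F where F: "finite F" "F \<subseteq> \<Gamma>" "F \<union> {\<phi> \<^bold>\<or> \<psi>} \<turnstile> \<chi>"
    using Disj_E1.IH by (rule finite_premises_split)
  from F(3) have "F \<union> {\<phi>} \<turnstile> \<chi>"
    by (rule derives.Disj_E1)
  with F show ?case
    by (intro exI[of _ "F \<union> {\<phi>}"]) auto
next
  case (Disj_E2 \<Gamma> \<phi> \<psi> \<chi>)
  obtain F where F: "finite F" "F \<subseteq> \<Gamma>" "F \<union> {\<phi> \<^bold>\<or> \<psi>} \<turnstile> \<chi>"
    using Disj_E2.IH by (rule finite_premises_split)
  from F(3) have "F \<union> {\<psi>} \<turnstile> \<chi>"
    by (rule derives.Disj_E2)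
  with F show ?case
    by (intro exI[of _ "F \<union> {\<psi>}"]) auto
qed

lemma maximal_non_deriving_extension:
  assumes "\<not> \<Gamma> \<turnstile> \<phi>"
  obtains \<Delta> where "\<Gamma> \<subseteq> \<Delta>" "\<not> \<Delta> \<turnstile> \<phi>" "\<And>\<psi>. \<psi> \<notin> \<Delta> \<Longrightarrow> \<Delta> \<union> {\<psi>} \<turnstile> \<phi>"
proof -
  let ?A = "{\<Delta>. \<Gamma> \<subseteq> \<Delta> \<and> \<not> \<Delta> \<turnstile> \<phi>}"
  have "\<exists>\<Delta>\<in>?A. \<forall>X\<in>?A. \<Delta> \<subseteq> X \<longrightarrow> X = \<Delta>"
  proof (rule subset_Zorn_nonempty)
    show "?A \<noteq> {}"
      using assms by blast
  next
    fix C
    assume C: "C \<noteq> {}" "subset.chain ?A C"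
    have "\<not> \<Union>C \<turnstile> \<phi>"
    proof
      assume "\<Union>C \<turnstile> \<phi>"
      then obtain F where F: "finite F" "F \<subseteq> \<Union>C" "F \<turnstile> \<phi>"
        using derives_finitary by blast
      obtain X where X: "X \<in> C" "F \<subseteq> X"
        using F(1,2) C by (rule finite_subset_Union_chain)
      from F(3) X(2) have "X \<turnstile> \<phi>"
        by (rule weakening)
      with C(2) X(1) show False
        unfolding subset.chain_def by blast
    qed
    moreover have "\<Gamma> \<subseteq> \<Union>C"
      using C unfolding subset.chain_def by blast
    ultimately show "\<Union>C \<in> ?A"
      by blast
  qed
  then obtain \<Delta> where "\<Delta> \<in> ?A" and max: "\<forall>X\<in>?A. \<Delta> \<subseteq> X \<longrightarrow> X = \<Delta>" ..
  then have \<Delta>: "\<Gamma> \<subseteq> \<Delta>" "\<not> \<Delta> \<turnstile> \<phi>"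
    by simp_all
  have "\<Delta> \<union> {\<psi>} \<turnstile> \<phi>" if "\<psi> \<notin> \<Delta>" for \<psi>
  proof (rule ccontr)
    assume "\<not> \<Delta> \<union> {\<psi>} \<turnstile> \<phi>"
    with \<Delta>(1) have "\<Delta> \<union> {\<psi>} \<in> ?A"
      by blast
    with max have "\<Delta> \<union> {\<psi>} = \<Delta>"
      by (metis Un_upper1)
    with that show False
      by blast
  qed
  with \<Delta> show thesis
    by (rule that)
qed

text \<open>Structural induction: closure under derivability gives the clause for conjunction and,
  by the introduction of disjunctions, half of the clause for disjunction; primeness is the
  other half. An atom is in \<open>\<Delta>\<close> exactly when it is true by the choice of assignment.\<close>

lemma val_maximal_iff:
  assumes non: "\<not> \<Delta> \<turnstile> \<chi>" and max: "\<And>\<psi>. \<psi> \<notin> \<Delta> \<Longrightarrow> \<Delta> \<union> {\<psi>} \<turnstile> \<chi>"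
  shows "val (\<lambda>p. Atom p \<in> \<Delta>) \<phi> \<longleftrightarrow> \<phi> \<in> \<Delta>"
proof -
  have closed: "\<psi> \<in> \<Delta>" if "\<Delta> \<turnstile> \<psi>" for \<psi>
  proof (rule ccontr)
    assume "\<psi> \<notin> \<Delta>"
    from derives.Trans[OF that max[OF this]] non show False
      by simp
  qed
  have prime: "\<psi> \<in> \<Delta> \<or> \<theta> \<in> \<Delta>" if "\<psi> \<^bold>\<or> \<theta> \<in> \<Delta>" for \<psi> \<theta>
  proof (rule ccontr)
    assume "\<not> (\<psi> \<in> \<Delta> \<or> \<theta> \<in> \<Delta>)"
    then have "\<Delta> \<union> {\<psi> \<^bold>\<or> \<theta>} \<turnstile> \<chi>"
      by (intro derives.Disj_I max) blast+
    with that non show False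
      by (simp add: insert_absorb)
  qed
  show ?thesis
  proof (induction \<phi>)
    case (Atom p)
    then show ?case
      by simp
  next
    case (Conj \<phi> \<psi>)
    have "\<phi> \<^bold>\<and> \<psi> \<in> \<Delta> \<longleftrightarrow> \<phi> \<in> \<Delta> \<and> \<psi> \<in> \<Delta>"
      by (blast intro: closed derives.Mem derives.Conj_I derives.Conj_E1 derives.Conj_E2)
    with Conj show ?case
      by simp
  next
    case (Disj \<phi> \<psi>)
    have "\<phi> \<^bold>\<or> \<psi> \<in> \<Delta> \<longleftrightarrow> \<phi> \<in> \<Delta> \<or> \<psi> \<in> \<Delta>"
      by (blast intro: closed derives.Mem derives_Disj1 derives_Disj2 dest: prime)
    with Disj show ?case
      by simp
  qed
qed

lemma completeness:
  assumes "\<Gamma> \<Turnstile> \<phi>"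
  shows "\<Gamma> \<turnstile> \<phi>"
proof (rule ccontr)
  assume "\<not> \<Gamma> \<turnstile> \<phi>"
  then obtain \<Delta> where \<Delta>: "\<Gamma> \<subseteq> \<Delta>" "\<not> \<Delta> \<turnstile> \<phi>" "\<And>\<psi>. \<psi> \<notin> \<Delta> \<Longrightarrow> \<Delta> \<union> {\<psi>} \<turnstile> \<phi>"
    by (rule maximal_non_deriving_extension) blast
  let ?v = "\<lambda>p. Atom p \<in> \<Delta>"
  have "val ?v \<psi> \<longleftrightarrow> \<psi> \<in> \<Delta>" for \<psi>
    using \<Delta>(2,3) by (rule val_maximal_iff)
  with assms \<Delta>(1) have "\<phi> \<in> \<Delta>"
    unfolding entails_def by blast
  with \<Delta>(2) show False
    by (blast intro: derives.Mem)
qed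

theorem proposition4:
  fixes \<Gamma> :: "'p fm set" and \<phi> :: "'p fm"
  assumes "infinite (UNIV :: 'p set)"
  shows "\<Gamma> \<turnstile> \<phi> \<longleftrightarrow> \<Gamma> \<Turnstile> \<phi>"
  using soundness completeness by blast

end
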